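(* Let $V,W\subset X$ be subspaces and let $P$ be the orthogonal projection of $X$ onto $W$. For an orthogonal partition $V=\bigoplus_{i=1}^k V_i$ (a direct sum of mutually orthogonal subspaces), $$\cos \Theta_{V,W} = \prod_{i=1}^k \cos \Theta_{V_i,W} \cdot \prod_{i=1}^{k-1}\cos \Theta^\perp_{P(V_i),P(V_{i+1}\oplus\cdots\oplus V_k)}.$$
   Context: $X$ is an $n$-dimensional vector space over $\mathbb{R}$ (real case) or $\mathbb{C}$ (complex case) with inner product $\langle\cdot,\cdot\rangle$ (Hermitian in the complex case, conjugate-linear in the first argument). Blades: a $p$-blade is a simple multivector $\nu=v_1\wedge\cdots\wedge v_p\in\Lambda^pX$; if $\nu\neq0$ it represents the $p$-dimensional subspace $V=\mathrm{span}(v_1,\ldots,v_p)$. Nonzero scalars in $\Lambda^0X$ are $0$-blades representing $\{0\}$. $\Lambda X$ has the inner product given on $p$-blades by $\langle v_1\wedge\cdots\wedge v_p,\,w_1\wedge\cdots\wedge w_p\rangle=\det(\langle v_i,w_j\rangle)$, extended (sesqui)linearly, with distinct grades orthogonal; $\|\nu\|=\sqrt{\langle\nu,\nu\rangle}$. Grassmann angle: for subspaces $V,W\subset X$, let $P_W$ be the orthogonal projection of $X$ onto $W$, acting on blades by $P_W(v_1\wedge\cdots\wedge v_p)=P_Wv_1\wedge\cdots\wedge P_Wv_p$ (identity on scalars). The Grassmann angle $\Theta_{V,W}\in[0,\frac\pi2]$ is defined by $\cos\Theta_{V,W}=\|P_W\nu\|/\|\nu\|$ for any nonzero blade $\nu$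 representing $V$ (independent of $\nu$); in particular $\Theta_{\{0\},W}=0$. The complementary Grassmann angle is $\Theta^\perp_{V,W}=\Theta_{V,W^\perp}$, where $W^\perp$ is the orthogonal complement of $W$ in $X$. Some subspaces of a partition may be $\{0\}$. *)

theory Defs
  imports Complex_Main "Jordan_Normal_Form.Determinant"
begin

text \<open>
  The two cases (real and Hermitian) are treated uniformly: up to isomorphism (of normed fields
  with involution), \<^typ>\<open>real\<close> and \<^typ>\<open>complex\<close> are the only instances of the following class.
  Indeed a self-conjugate \<open>z\<close> satisfies \<open>z\<^sup>2 = (norm z)\<^sup>2\<close>, hence is real, and every \<open>z\<close> is
  a root of a quadratic polynomial with the real coefficients \<open>z + conjugate z\<close>
  and \<open>z * conjugate z\<close>.
\<close>

class real_or_complex = real_normed_field + conjugatable_field +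
  assumes mult_conjugate: "x * conjugate x = (norm x)\<^sup>2 *\<^sub>R 1"

instance real :: real_or_complex
  by standard (simp add: power2_eq_square)

instance complex :: real_or_complex
  by standard (simp add: complex_norm_square[symmetric] scaleR_conv_of_real)

locale fin_dim_inner_space = vector_space scale
  for scale :: "'k::real_or_complex \<Rightarrow> 'x::ab_group_add \<Rightarrow> 'x" +
  fixes ip :: "'x \<Rightarrow> 'x \<Rightarrow> 'k"
  assumes fin_dim: "\<exists>B. finite B \<and> span B = UNIV"
    and ip_add_right: "ip x (y + z) = ip x y + ip x z"
    and ip_scale_right: "ip x (scale c y) = c * ip x y"
    and ip_conjugate: "ip y x = conjugate (ip x y)"
    and ip_pos: "x \<noteq> 0 \<Longrightarrow> \<exists>r>0. ip x x = of_real r"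

definition subspace_sum :: "('i \<Rightarrow> 'x::comm_monoid_add set) \<Rightarrow> 'i set \<Rightarrow> 'x set" where
  "subspace_sum Vs I = {(\<Sum>i\<in>I. x i) | x. \<forall>i\<in>I. x i \<in> Vs i}"

text \<open>
  The exterior algebra of a finite-dimensional \<open>X\<close> is realised as the graded dual of the
  space of alternating multilinear forms on \<open>X\<close>.  A family of such forms, one for each number of
  arguments, is a function on lists, and \<open>v\<^sub>1 \<and> \<dots> \<and> v\<^sub>p\<close> is evaluation at
  \<open>[v\<^sub>1, \<dots>, v\<^sub>p]\<close>.  So two wedge products agree iff no alternating form distinguishes
  them, which is the universal property.  The empty wedge product is the scalar 1.
\<close>

type_synonym ('k, 'x) multivector = "('x list \<Rightarrow> 'k) \<Rightarrow> 'k"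

context fin_dim_inner_space
begin

definition alternating :: "('x list \<Rightarrow> 'k) \<Rightarrow> bool" where
  "alternating \<omega> \<longleftrightarrow>
     (\<forall>us x y ws. \<omega> (us @ (x + y) # ws) = \<omega> (us @ x # ws) + \<omega> (us @ y # ws)) \<and>
     (\<forall>us c x ws. \<omega> (us @ scale c x # ws) = c * \<omega> (us @ x # ws)) \<and>
     (\<forall>us x vs ws. \<omega> (us @ x # vs @ x # ws) = 0)"

definition wedge :: "'x list \<Rightarrow> ('k, 'x) multivector" where
  "wedge vs = (\<lambda>\<omega>. if alternating \<omega> then \<omega> vs else 0)"

text \<open>
  The scalar \<open>c\<close> is needed only for \<open>vs = []\<close>, to obtain all 0-blades; otherwise
  it can be absorbed into a factor.
\<close>

definition blade_represents :: "('k, 'x) multivector \<Rightarrow> 'x set \<Rightarrow> bool" where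
  "blade_represents \<nu> V \<longleftrightarrow>
     \<nu> \<noteq> (\<lambda>_. 0) \<and> (\<exists>c vs. \<nu> = (\<lambda>\<omega>. c * wedge vs \<omega>) \<and> span (set vs) = V)"

definition gram :: "'x list \<Rightarrow> 'x list \<Rightarrow> 'k" where
  "gram vs ws = (if length vs = length ws
     then det (mat (length vs) (length vs) (\<lambda>(i, j). ip (vs ! i) (ws ! j))) else 0)"

text \<open>
  The sesquilinear extension (conjugate-linear in the first argument) of \<^term>\<open>gram\<close>: for a fixed
  list \<open>vs\<close> the function \<open>gram vs\<close> is alternating, so a multivector \<open>\<nu>\<close> can be applied to it;
  the conjugate of the result is again alternating in \<open>vs\<close>, so \<open>\<mu>\<close> can be applied.
  See \<open>mv_inner_combination\<close> below.
\<close>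

definition mv_inner :: "('k, 'x) multivector \<Rightarrow> ('k, 'x) multivector \<Rightarrow> 'k" where
  "mv_inner \<mu> \<nu> = conjugate (\<mu> (\<lambda>vs. conjugate (\<nu> (gram vs))))"

text \<open>
  The number \<open>mv_inner \<nu> \<nu>\<close> is real and nonnegative; \<^const>\<open>norm\<close> only converts it to type
  \<^typ>\<open>real\<close>.
\<close>

definition mv_norm :: "('k, 'x) multivector \<Rightarrow> real" where
  "mv_norm \<nu> = sqrt (norm (mv_inner \<nu> \<nu>))"

text \<open>
  The linear extension of a linear map to multivectors is the transpose of the pullback of
  alternating forms; see \<open>mv_map_combination\<close> below.
\<close>

definition mv_map :: "('x \<Rightarrow> 'x) \<Rightarrow> ('k, 'x) multivector \<Rightarrow> ('k, 'x) multivector" where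
  "mv_map f \<nu> = (\<lambda>\<omega>. if alternating \<omega> then \<nu> (\<lambda>vs. \<omega> (map f vs)) else 0)"

definition orth_compl :: "'x set \<Rightarrow> 'x set" where
  "orth_compl W = {x. \<forall>w\<in>W. ip w x = 0}"

definition orth_proj :: "'x set \<Rightarrow> 'x \<Rightarrow> 'x" where
  "orth_proj W x = (THE y. y \<in> W \<and> x - y \<in> orth_compl W)"

definition grassmann_angle :: "'x set \<Rightarrow> 'x set \<Rightarrow> real" where
  "grassmann_angle V W = (THE \<theta>. 0 \<le> \<theta> \<and> \<theta> \<le> pi / 2 \<and>
     (\<forall>\<nu>. blade_represents \<nu> V \<longrightarrow> cos \<theta> = mv_norm (mv_map (orth_proj W) \<nu>) / mv_norm \<nu>))"

definition compl_grassmann_angle :: "'x set \<Rightarrow> 'x set \<Rightarrow> real" where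
  "compl_grassmann_angle V W = grassmann_angle V (orth_compl W)"

text \<open>Mutual orthogonality makes the sum automatically direct.\<close>

definition orthogonal_partition :: "'x set \<Rightarrow> nat \<Rightarrow> (nat \<Rightarrow> 'x set) \<Rightarrow> bool" where
  "orthogonal_partition V k Vs \<longleftrightarrow>
     (\<forall>i\<in>{1..k}. subspace (Vs i)) \<and>
     (\<forall>i\<in>{1..k}. \<forall>j\<in>{1..k}. i \<noteq> j \<longrightarrow> (\<forall>x\<in>Vs i. \<forall>y\<in>Vs j. ip x y = 0)) \<and>
     V = subspace_sum Vs {1..k}"

lemma conjugate_gram: "conjugate (gram vs ws) = gram ws vs"
proof (cases "length vs = length ws")
  case True
  let ?n = "length vs"
  interpret conj: comm_ring_hom "conjugate :: 'k \<Rightarrow> 'k"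
  proof
    show "conjugate (1::'k) = 1"
      using mult_conjugate[of "1::'k"] by simp
  qed (auto simp: conjugate_dist_add conjugate_dist_mul)
  let ?A = "mat ?n ?n (\<lambda>(i, j). ip (vs ! i) (ws ! j))"
  let ?B = "mat ?n ?n (\<lambda>(i, j). ip (ws ! i) (vs ! j))"
  have "map_mat conjugate ?A = transpose_mat ?B"
    by (rule eq_matI) (auto simp: ip_conjugate[symmetric])
  then have "conjugate (det ?A) = det (transpose_mat ?B)"
    by (metis conj.hom_det)
  also have "\<dots> = det ?B"
    by (rule det_transpose[of _ ?n]) simp
  finally show ?thesis
    using True by (simp add: gram_def)
qed (simp add: gram_def)

lemma ip_add_left: "ip (x + y) z = ip x z + ip y z"
  by (metis ip_conjugate ip_add_right conjugate_dist_add)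

lemma gram_expand:
  assumes "length vs = length us + Suc (length ws)"
  shows "gram vs (us @ x # ws) = (\<Sum>p | p permutes {0..<length vs}. signof p *
    (\<Prod>i\<in>{0..<length vs}. ip (vs ! i) ((us @ x # ws) ! p i)))"
proof -
  have "gram vs (us @ x # ws) = (\<Sum>p | p permutes {0..<length vs}. signof p *
    (\<Prod>i\<in>{0..<length vs}. mat (length vs) (length vs)
        (\<lambda>(i, j). ip (vs ! i) ((us @ x # ws) ! j)) $$ (i, p i)))"
    using assms by (simp add: gram_def det_def)
  also have "\<dots> = (\<Sum>p | p permutes {0..<length vs}. signof p *
    (\<Prod>i\<in>{0..<length vs}. ip (vs ! i) ((us @ x # ws) ! p i)))"
    by (intro sum.cong prod.cong arg_cong2[where f = "(*)"] refl)
       (auto dest: permutes_in_image)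
  finally show ?thesis .
qed

text \<open>The product over a permutation depends on \<open>x\<close> through exactly one factor.\<close>

lemma gram_factor:
  assumes len: "length vs = length us + Suc (length ws)"
  shows "\<exists>a. \<forall>x. gram vs (us @ x # ws) =
    (\<Sum>p | p permutes {0..<length vs}. a p * ip (vs ! Hilbert_Choice.inv p (length us)) x)"
proof -
  define a where "a p = (signof p :: 'k) * (\<Prod>i\<in>{0..<length vs} - {Hilbert_Choice.inv p (length us)}.
     ip (vs ! i) ((us @ 0 # ws) ! p i))" for p
  have "gram vs (us @ x # ws) =
    (\<Sum>p | p permutes {0..<length vs}. a p * ip (vs ! Hilbert_Choice.inv p (length us)) x)" for x
    unfolding gram_expand[OF len]
  proof (rule sum.cong[OF refl])
    fix p assume "p \<in> {p. p permutes {0..<length vs}}"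
    then have p: "p permutes {0..<length vs}" by simp
    let ?m = "Hilbert_Choice.inv p (length us)"
    have m: "?m \<in> {0..<length vs}"
      using permutes_in_image[OF permutes_inv[OF p], of "length us"] len by simp
    have pm: "p ?m = length us"
      using p by (simp add: permutes_inverses)
    have ne: "p i \<noteq> length us" if "i \<noteq> ?m" for i
      using that p by (metis permutes_inverses(2))
    have "(\<Prod>i\<in>{0..<length vs}. ip (vs ! i) ((us @ x # ws) ! p i)) =
      ip (vs ! ?m) ((us @ x # ws) ! p ?m) *
      (\<Prod>i\<in>{0..<length vs} - {?m}. ip (vs ! i) ((us @ x # ws) ! p i))"
      by (rule prod.remove) (use m in auto)
    also have "(\<Prod>i\<in>{0..<length vs} - {?m}. ip (vs ! i) ((us @ x # ws) ! p i)) =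
      (\<Prod>i\<in>{0..<length vs} - {?m}. ip (vs ! i) ((us @ 0 # ws) ! p i))"
    proof (rule prod.cong[OF refl])
      fix i assume "i \<in> {0..<length vs} - {?m}"
      then have "p i \<noteq> length us" using ne by blast
      then show "ip (vs ! i) ((us @ x # ws) ! p i) = ip (vs ! i) ((us @ 0 # ws) ! p i)"
        by (auto simp: nth_append nth_Cons split: nat.splits)
    qed
    finally show "signof p * (\<Prod>i\<in>{0..<length vs}. ip (vs ! i) ((us @ x # ws) ! p i)) =
        a p * ip (vs ! ?m) x"
      by (simp add: pm a_def)
  qed
  then show ?thesis by blast
qed

lemma alternating_gram: "alternating (gram vs)"
  unfolding alternating_def
proof (intro conjI allI)
  fix us ws :: "'x list" and x y :: 'x and c :: 'k
  show "gram vs (us @ (x + y) # ws) = gram vs (us @ x # ws) + gram vs (us @ y # ws)"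
  proof (cases "length vs = length us + Suc (length ws)")
    case True
    from gram_factor[OF this] obtain a where a: "\<And>x. gram vs (us @ x # ws) =
      (\<Sum>p | p permutes {0..<length vs}. a p * ip (vs ! Hilbert_Choice.inv p (length us)) x)" by blast
    show ?thesis
      by (simp add: a ip_add_right distrib_left sum.distrib)
  qed (simp add: gram_def)
  show "gram vs (us @ scale c x # ws) = c * gram vs (us @ x # ws)"
  proof (cases "length vs = length us + Suc (length ws)")
    case True
    from gram_factor[OF this] obtain a where a: "\<And>x. gram vs (us @ x # ws) =
      (\<Sum>p | p permutes {0..<length vs}. a p * ip (vs ! Hilbert_Choice.inv p (length us)) x)" by blast
    show ?thesis
      by (simp add: a ip_scale_right sum_distrib_left ac_simps)
  qed (simp add: gram_def)
next
  fix us zs ws :: "'x list" and x :: 'x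
  let ?l = "us @ x # zs @ x # ws"
  show "gram vs ?l = 0"
  proof (cases "length vs = length ?l")
    case True
    let ?n = "length vs"
    let ?j = "Suc (length us + length zs)"
    have nth: "?l ! length us = x" "?l ! ?j = x"
      by (simp_all add: nth_append)
    have "det (mat ?n ?n (\<lambda>(i, j). ip (vs ! i) (?l ! j))) = 0"
      by (rule det_identical_columns[of _ ?n "length us" ?j])
         (use True nth in \<open>auto simp: col_def\<close>)
    then show ?thesis using True by (simp add: gram_def)
  qed (simp add: gram_def)
qed

lemma conjugate_sum': "conjugate (\<Sum>a\<in>A. f a :: 'k) = (\<Sum>a\<in>A. conjugate (f a))"
  by (cases "finite A") (simp_all add: sum_conjugate)

lemma alternating_sum:
  assumes "\<And>a. a \<in> A \<Longrightarrow> alternating (F a)"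
  shows "alternating (\<lambda>vs. \<Sum>a\<in>A. c a * F a vs)"
proof -
  have "F a (us @ (x + y) # ws) = F a (us @ x # ws) + F a (us @ y # ws)"
       "F a (us @ scale d x # ws) = d * F a (us @ x # ws)"
       "F a (us @ x # vs @ x # ws) = 0"
    if "a \<in> A" for a us x y vs ws d
    using assms[OF that] unfolding alternating_def by blast+
  then show ?thesis
    unfolding alternating_def
    by (simp add: distrib_left sum.distrib sum_distrib_left ac_simps)
qed

theorem mv_inner_combination:
  "mv_inner (\<lambda>\<omega>. \<Sum>a\<in>A. c a * wedge (f a) \<omega>) (\<lambda>\<omega>. \<Sum>b\<in>B. d b * wedge (g b) \<omega>) =
    (\<Sum>a\<in>A. \<Sum>b\<in>B. conjugate (c a) * d b * gram (f a) (g b))"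
proof -
  have "(\<lambda>vs. conjugate (\<Sum>b\<in>B. d b * wedge (g b) (gram vs))) =
    (\<lambda>vs. \<Sum>b\<in>B. conjugate (d b) * gram (g b) vs)"
    by (simp add: wedge_def alternating_gram conjugate_sum' conjugate_dist_mul conjugate_gram)
  moreover have "alternating (\<lambda>vs. \<Sum>b\<in>B. conjugate (d b) * gram (g b) vs)"
    by (rule alternating_sum) (rule alternating_gram)
  ultimately show ?thesis
    by (simp add: mv_inner_def wedge_def conjugate_sum' conjugate_dist_mul conjugate_gram
        sum_distrib_left mult.assoc alternating_gram)
qed

corollary mv_inner_wedge: "mv_inner (wedge vs) (wedge ws) = gram vs ws"
  using alternating_gram
  by (simp add: mv_inner_def wedge_def conjugate_gram)

lemma alternating_pullback:
  assumes "Vector_Spaces.linear scale scale f" "alternating \<omega>"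
  shows "alternating (\<lambda>vs. \<omega> (map f vs))"
proof -
  interpret f: Vector_Spaces.linear scale scale f by fact
  show ?thesis
    using assms(2) by (simp add: alternating_def f.add f.scale)
qed

theorem mv_map_combination:
  assumes "Vector_Spaces.linear scale scale f"
  shows "mv_map f (\<lambda>\<omega>. \<Sum>a\<in>A. c a * wedge (g a) \<omega>) =
    (\<lambda>\<omega>. \<Sum>a\<in>A. c a * wedge (map f (g a)) \<omega>)"
  by (auto simp: mv_map_def wedge_def alternating_pullback[OF assms])

end

end

theory Submission
  imports Defs
begin

text \<open>
  If \<open>vs\<close> is a basis of \<open>V\<close>, then the squared cosine of the Grassmann angle is the quotient of
  the Gram determinants \<open>G (P vs)\<close> and \<open>G vs\<close>.  Let \<open>V = A \<oplus> B\<close> be an orthogonal sum with bases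
  \<open>as\<close> and \<open>bs\<close>, and let \<open>Q\<close> be the projection onto the orthogonal complement of \<open>P B\<close>.  Then
  \<open>G (as @ bs) = G as * G bs\<close>, and, as \<open>P a - Q (P a)\<close> lies in \<open>P B\<close>, column operations give
  \<open>G (P as @ P bs) = G (Q (P as)) * G (P bs)\<close>.  Dividing yields the case of two
  summands; when \<open>P as\<close> is linearly dependent both sides vanish.  Splitting off one summand at a
  time gives the general case.
\<close>

context fin_dim_inner_space
begin

section \<open>The inner product\<close>

lemma ip_scale_left: "ip (scale c x) y = conjugate c * ip x y"
  by (metis ip_conjugate ip_scale_right conjugate_dist_mul)

lemma ip_zero_right [simp]: "ip x 0 = 0"
  using ip_add_right[of x 0 0] by simp

lemma ip_zero_left [simp]: "ip 0 x = 0"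
  using ip_add_left[of 0 0 x] by simp

lemma ip_diff_right: "ip x (y - z) = ip x y - ip x z"
  using ip_add_right[of x "y - z" z] by (simp add: algebra_simps)

lemma ip_sum_right: "ip x (\<Sum>i\<in>I. f i) = (\<Sum>i\<in>I. ip x (f i))"
  by (induction I rule: infinite_finite_induct) (auto simp: ip_add_right)

lemma ip_sum_left: "ip (\<Sum>i\<in>I. f i) x = (\<Sum>i\<in>I. ip (f i) x)"
  by (induction I rule: infinite_finite_induct) (auto simp: ip_add_left)

lemma ip_commute_zero: "ip x y = 0 \<longleftrightarrow> ip y x = 0"
  by (metis ip_conjugate conjugate_zero_iff)

lemma ip_self_eq_0 [simp]: "ip x x = 0 \<longleftrightarrow> x = 0"
  using ip_pos[of x] by (metis ip_zero_right less_irrefl of_real_eq_0_iff)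

text \<open>The scalar field \<open>'k\<close> carries no order; this is what allows squared lengths
  to be compared as the real numbers \<open>norm (ip x x)\<close>.\<close>

lemma ip_self_of_real: "ip x x = of_real (norm (ip x x))"
  using ip_pos[of x] by (cases "x = 0") (auto simp: norm_of_real)

lemma norm_ip_pythagoras:
  assumes "ip x y = 0"
  shows "norm (ip (x + y) (x + y)) = norm (ip x x) + norm (ip y y)"
proof -
  have "ip (x + y) (x + y) = ip x x + ip y y"
    using assms ip_commute_zero[of x y] by (simp add: ip_add_left ip_add_right)
  also have "\<dots> = of_real (norm (ip x x)) + of_real (norm (ip y y))"
    by (metis ip_self_of_real)
  also have "\<dots> = of_real (norm (ip x x) + norm (ip y y))"
    by simp
  finally show ?thesis
    by (metis norm_of_real abs_of_nonneg add_nonneg_nonneg norm_ge_zero)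
qed

section \<open>Orthogonal projections\<close>

lemma subspace_orth_compl: "subspace (orth_compl W)"
  by (rule subspaceI) (auto simp: orth_compl_def ip_add_right ip_scale_right)

lemma orth_complD: "x \<in> orth_compl W \<Longrightarrow> w \<in> W \<Longrightarrow> ip w x = 0"
  by (simp add: orth_compl_def)

lemma orth_compl_span: "orth_compl (span S) = orth_compl S"
proof
  show "orth_compl (span S) \<subseteq> orth_compl S"
    by (auto simp: orth_compl_def intro: span_base)
  show "orth_compl S \<subseteq> orth_compl (span S)"
  proof
    fix x assume x: "x \<in> orth_compl S"
    have "ip w x = 0" if "w \<in> span S" for w
      using that by (induction rule: span_induct_alt)
        (use x in \<open>auto simp: ip_add_left ip_scale_left orth_compl_def\<close>)
    then show "x \<in> orth_compl (span S)" by (simp add: orth_compl_def)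
  qed
qed

text \<open>One Gram-Schmidt step per vector: the part \<open>u\<close> of \<open>v\<close>
  orthogonal to the span of \<open>vs\<close> is the only new direction, so it suffices to add to
  \<open>y\<close> the component of \<open>x\<close> along \<open>u\<close>.\<close>

lemma orth_decomposition_span_list: "\<exists>y\<in>span (set vs). x - y \<in> orth_compl (span (set vs))"
proof (induction vs arbitrary: x)
  case Nil
  show ?case by (auto simp: orth_compl_def)
next
  case (Cons v vs)
  obtain w where w: "w \<in> span (set vs)" "v - w \<in> orth_compl (span (set vs))"
    using Cons by blast
  obtain y where y: "y \<in> span (set vs)" "x - y \<in> orth_compl (span (set vs))"
    using Cons by blast
  define u where "u = v - w"
  \<comment> \<open>Chosen so that \<open>x - (y + scale c u)\<close> is orthogonal to
    \<open>u\<close>. If \<open>u = 0\<close>, division by zero gives \<open>c = 0\<close> and that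
    orthogonality is trivial.\<close>
  define c where "c = ip u x / ip u u"
  have sub: "span (set vs) \<subseteq> span (set (v # vs))"
    by (rule span_mono) auto
  have u: "u \<in> span (set (v # vs))"
    unfolding u_def using w sub by (intro span_diff) (auto intro: span_base)
  have uy: "ip u y = 0"
    using w(2) y(1) unfolding u_def by (metis orth_complD ip_commute_zero)
  have uz: "ip u (x - (y + scale c u)) = 0"
    using uy by (cases "u = 0") (auto simp: ip_diff_right ip_add_right ip_scale_right c_def)
  have vsz: "ip z (x - (y + scale c u)) = 0" if "z \<in> span (set vs)" for z
    using orth_complD[OF y(2) that] orth_complD[OF w(2) that]
    by (simp add: ip_diff_right ip_add_right ip_scale_right u_def algebra_simps)
  have "v = u + w" by (simp add: u_def)
  then have "ip v (x - (y + scale c u)) = 0"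
    using uz vsz[OF w(1)] by (simp add: ip_add_left)
  then have "x - (y + scale c u) \<in> orth_compl (set (v # vs))"
    using vsz by (auto simp: orth_compl_def intro: span_base)
  moreover have "y + scale c u \<in> span (set (v # vs))"
    using y(1) u sub by (auto intro!: span_add span_scale)
  ultimately show ?case
    unfolding orth_compl_span by blast
qed

lemma subspace_basis_list:
  assumes "subspace V"
  obtains vs where "distinct vs" "independent (set vs)" "span (set vs) = V"
proof -
  obtain B where B: "B \<subseteq> V" "independent B" "V \<subseteq> span B"
    by (rule maximal_independent_subset)
  have "finite B"
    using fin_dim independent_span_bound[OF _ B(2)] by blast
  moreover have "span B = V"
    using B assms by (simp add: span_minimal subset_antisym)
  ultimately show ?thesis
    using B(2) that finite_distinct_list by metis
qed

lemma orth_decomposition_unique: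
  assumes "subspace W" "y \<in> W" "x - y \<in> orth_compl W" "z \<in> W" "x - z \<in> orth_compl W"
  shows "y = z"
proof -
  have "y - z \<in> W" using assms by (simp add: subspace_diff)
  moreover have "y - z \<in> orth_compl W"
    using subspace_diff[OF subspace_orth_compl assms(5,3)] by simp
  ultimately have "ip (y - z) (y - z) = 0" by (simp add: orth_compl_def)
  then show ?thesis by simp
qed

lemma orth_proj_eqI:
  assumes "subspace W" "y \<in> W" "x - y \<in> orth_compl W"
  shows "orth_proj W x = y"
  unfolding orth_proj_def using assms orth_decomposition_unique by blast

lemma orth_proj_decomposition:
  assumes "subspace W"
  shows "orth_proj W x \<in> W" "x - orth_proj W x \<in> orth_compl W"
proof -
  obtain vs where "span (set vs) = W" using subspace_basis_list[OF assms] .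
  then obtain y where "y \<in> W" "x - y \<in> orth_compl W"
    using orth_decomposition_span_list by blast
  with orth_proj_eqI[OF assms this] show "orth_proj W x \<in> W" "x - orth_proj W x \<in> orth_compl W"
    by simp_all
qed

lemma linear_orth_proj:
  assumes W: "subspace W"
  shows "Vector_Spaces.linear scale scale (orth_proj W)"
proof (unfold_locales)
  fix x y c
  note d = orth_proj_decomposition[OF W]
  show "orth_proj W (x + y) = orth_proj W x + orth_proj W y"
    using subspace_add[OF W d(1) d(1)] subspace_add[OF subspace_orth_compl d(2) d(2), of x y]
    by (intro orth_proj_eqI[OF W]) (auto simp: algebra_simps)
  show "orth_proj W (scale c x) = scale c (orth_proj W x)"
    using subspace_scale[OF W d(1)] subspace_scale[OF subspace_orth_compl d(2), of c x]
    by (intro orth_proj_eqI[OF W]) (auto simp: scale_right_diff_distrib)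
qed

lemma norm_ip_add_orth_compl_le:
  assumes "y \<in> W" "z \<in> orth_compl W"
  shows "norm (ip y y) \<le> norm (ip (y + z) (y + z))" "norm (ip z z) \<le> norm (ip (y + z) (y + z))"
  using norm_ip_pythagoras[OF orth_complD[OF assms(2,1)]] by simp_all

lemma orth_proj_norm_le:
  assumes "subspace W"
  shows "norm (ip (orth_proj W x) (orth_proj W x)) \<le> norm (ip x x)"
  using norm_ip_add_orth_compl_le(1)[OF orth_proj_decomposition(1,2)[OF assms, of x]] by simp

text \<open>Best approximation by Pythagoras: \<open>x - w\<close> is the sum of
  \<open>orth_proj W x - w\<close> in \<open>W\<close> and \<open>x - orth_proj W x\<close>
  orthogonal to \<open>W\<close>.\<close>

lemma orth_proj_dist_le:
  assumes W: "subspace W" and w: "w \<in> W"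
  shows "norm (ip (x - orth_proj W x) (x - orth_proj W x)) \<le> norm (ip (x - w) (x - w))"
  using norm_ip_add_orth_compl_le(2)[OF subspace_diff[OF W orth_proj_decomposition(1)[OF W] w]
      orth_proj_decomposition(2)[OF W], of x x] by simp

text \<open>Exchanging the two parts in the decomposition of \<open>x\<close> along \<open>U\<close>
  identifies its projection onto \<open>orth_compl U\<close> as \<open>x - orth_proj U x\<close>;
  only the inclusion of \<open>U\<close> in its double complement enters.\<close>

lemma diff_orth_proj_orth_compl:
  assumes U: "subspace U"
  shows "x - orth_proj (orth_compl U) x \<in> U"
proof -
  have "x - (x - orth_proj U x) \<in> orth_compl (orth_compl U)"
    using orth_proj_decomposition(1)[OF U, of x] by (auto simp: orth_compl_def ip_commute_zero)
  then have "orth_proj (orth_compl U) x = x - orth_proj U x"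
    using orth_proj_decomposition(2)[OF U, of x] by (intro orth_proj_eqI[OF subspace_orth_compl])
  then show ?thesis
    using orth_proj_decomposition(1)[OF U, of x] by simp
qed

section \<open>Alternating forms and Gram determinants\<close>

lemma alternating_Cons:
  assumes "alternating \<omega>"
  shows "alternating (\<lambda>vs. \<omega> (x # vs))"
  using assms unfolding alternating_def by (metis append_Cons)

lemma alternating_Cons_add: "alternating \<omega> \<Longrightarrow> \<omega> ((x + y) # vs) = \<omega> (x # vs) + \<omega> (y # vs)"
  unfolding alternating_def by (metis append_Nil)

lemma alternating_Cons_scale: "alternating \<omega> \<Longrightarrow> \<omega> (scale c x # vs) = c * \<omega> (x # vs)"
  unfolding alternating_def by (metis append_Nil)

text \<open>By linearity in the first argument it is enough to let \<open>x\<close> be an entry of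
  \<open>vs\<close>, and then an argument is repeated.\<close>

lemma alternating_Cons_in_span:
  assumes "alternating \<omega>" "x \<in> span (set vs)"
  shows "\<omega> (x # vs) = 0"
  using assms(2)
proof (induction rule: span_induct_alt)
  case base
  show ?case using alternating_Cons_scale[OF assms(1), of 0 0 vs] by simp
next
  case (step c x y)
  from split_list[OF step(1)] obtain as bs where "vs = as @ x # bs" by blast
  then have "\<omega> (x # vs) = 0"
    using assms(1) unfolding alternating_def by (metis append_Nil)
  with step show ?case
    using assms(1) by (simp add: alternating_Cons_add alternating_Cons_scale)
qed

text \<open>Column operations: each entry of \<open>xs\<close> changes by a combination of
  \<open>ys\<close>. Freezing the modified first entry leaves another alternating form, which is why
  the induction varies \<open>\<omega>\<close>.\<close>

lemma alternating_append_cong: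
  assumes "alternating \<omega>" "\<And>x. x \<in> set xs \<Longrightarrow> x - f x \<in> span (set ys)"
  shows "\<omega> (map f xs @ ys) = \<omega> (xs @ ys)"
  using assms
proof (induction xs arbitrary: \<omega>)
  case (Cons x xs)
  have "x - f x \<in> span (set (xs @ ys))"
    using Cons.prems(2)[of x] span_mono[of "set ys" "set (xs @ ys)"] by auto
  then have "\<omega> ((x - f x) # xs @ ys) = 0"
    using Cons.prems(1) by (rule alternating_Cons_in_span[rotated])
  then have "\<omega> (x # xs @ ys) = \<omega> (f x # xs @ ys)"
    using alternating_Cons_add[OF Cons.prems(1), of "x - f x" "f x" "xs @ ys"] by simp
  also have "\<dots> = \<omega> (f x # map f xs @ ys)"
    using Cons.IH[OF alternating_Cons[OF Cons.prems(1)]] Cons.prems(2) by simp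
  finally show ?case by simp
qed simp

text \<open>The Gram determinant is alternating in its second list; conjugate symmetry carries the
  same replacement over to the first.\<close>

lemma gram_append_cong:
  assumes "\<And>x. x \<in> set xs \<Longrightarrow> x - f x \<in> span (set ys)"
  shows "gram (map f xs @ ys) (map f xs @ ys) = gram (xs @ ys) (xs @ ys)"
  using alternating_append_cong[OF alternating_gram assms] by (metis conjugate_gram)

text \<open>Orthogonality makes the Gram matrix block diagonal.\<close>

lemma gram_append_orth:
  assumes orth: "\<And>x y. x \<in> set xs \<Longrightarrow> y \<in> set ys \<Longrightarrow> ip x y = 0"
  shows "gram (xs @ ys) (xs @ ys) = gram xs xs * gram ys ys"
proof -
  let ?m = "length xs" and ?n = "length ys"
  let ?A = "mat ?m ?m (\<lambda>(i, j). ip (xs ! i) (xs ! j))"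
  let ?B = "mat ?n ?n (\<lambda>(i, j). ip (ys ! i) (ys ! j))"
  have orth': "ip y x = 0" if "x \<in> set xs" "y \<in> set ys" for x y
    using orth[OF that] ip_commute_zero by blast
  have "mat (?m + ?n) (?m + ?n) (\<lambda>(i, j). ip ((xs @ ys) ! i) ((xs @ ys) ! j)) =
      four_block_mat ?A (0\<^sub>m ?m ?n) (0\<^sub>m ?n ?m) ?B"
    by (rule eq_matI) (auto simp: nth_append orth orth')
  moreover have "det (four_block_mat ?A (0\<^sub>m ?m ?n) (0\<^sub>m ?n ?m) ?B) = det ?A * det ?B"
    by (rule det_four_block_mat_upper_right_zero[of _ ?m _ ?n]) auto
  ultimately show ?thesis
    by (simp add: gram_def)
qed

lemma gram_Nil [simp]: "gram [] [] = 1"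
  by (simp add: gram_def)

lemma gram_singleton: "gram [x] [x] = ip x x"
  by (simp add: gram_def det_single)

text \<open>The squared volume of a parallelepiped is the squared height over a face times the
  squared volume of that face.\<close>

lemma gram_Cons:
  fixes x vs
  defines "h \<equiv> x - orth_proj (span (set vs)) x"
  shows "gram (x # vs) (x # vs) = ip h h * gram vs vs"
proof -
  have d: "orth_proj (span (set vs)) x \<in> span (set vs)" "h \<in> orth_compl (span (set vs))"
    unfolding h_def by (simp_all add: orth_proj_decomposition)
  have "gram (map (\<lambda>_. h) [x] @ vs) (map (\<lambda>_. h) [x] @ vs) = gram ([x] @ vs) ([x] @ vs)"
    by (rule gram_append_cong) (use d in \<open>simp add: h_def\<close>)
  moreover have "gram ([h] @ vs) ([h] @ vs) = gram [h] [h] * gram vs vs"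
    by (rule gram_append_orth)
      (use d(2) in \<open>auto simp: orth_compl_def span_base ip_commute_zero[of h]\<close>)
  ultimately show ?thesis by (simp add: gram_singleton)
qed

lemma gram_Cons_eq_0_iff:
  "gram (x # vs) (x # vs) = 0 \<longleftrightarrow> x \<in> span (set vs) \<or> gram vs vs = 0"
proof -
  let ?p = "orth_proj (span (set vs)) x"
  have "x = ?p \<longleftrightarrow> x \<in> span (set vs)"
    using orth_proj_decomposition(1)[OF subspace_span, of "set vs" x]
      orth_proj_eqI[OF subspace_span, of x "set vs" x] subspace_0[OF subspace_orth_compl] by auto
  then show ?thesis by (auto simp: gram_Cons)
qed

text \<open>The volume vanishes exactly when some height does, that is, when an entry lies in the
  span of its successors. Repeated entries are excluded separately because \<open>set\<close>
  forgets them.\<close>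

lemma gram_nonzero_iff: "gram vs vs \<noteq> 0 \<longleftrightarrow> distinct vs \<and> independent (set vs)"
  by (induction vs) (auto simp: gram_Cons_eq_0_iff independent_insert independent_empty span_base)

text \<open>A zero Gram determinant detects linear dependence, so the wedge product of such a list
  is zero. Hence the list behind a nonzero blade has a nonzero Gram determinant.\<close>

lemma alternating_eq_0:
  assumes "alternating \<omega>" "gram vs vs = 0"
  shows "\<omega> vs = 0"
  using assms
  by (induction vs arbitrary: \<omega>)
    (auto simp: gram_Cons_eq_0_iff alternating_Cons_in_span dest: alternating_Cons)

text \<open>The squared volume is a product of squared heights, and projecting shrinks each of them.
  The bound keeps the quotient in \<open>cos_grassmann_angle\<close> at most 1, inside the domain of
  \<open>arccos\<close>.\<close>

lemma gram_map_orth_proj_le: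
  assumes W: "subspace W"
  shows "norm (gram (map (orth_proj W) vs) (map (orth_proj W) vs)) \<le> norm (gram vs vs)"
proof (induction vs)
  case (Cons x vs)
  let ?P = "orth_proj W" and ?S = "span (set vs)"
  interpret P: Vector_Spaces.linear scale scale ?P by (rule linear_orth_proj[OF W])
  let ?S' = "span (set (map ?P vs))"
  let ?h = "x - orth_proj ?S x" and ?h' = "?P x - orth_proj ?S' (?P x)"
  \<comment> \<open>The image of the foot of the perpendicular competes in \<open>?S'\<close> for
    the distance to \<open>?P x\<close>; its difference from \<open>?P x\<close> is
    \<open>?P ?h\<close>.\<close>
  have "?P (orth_proj ?S x) \<in> ?S'"
    using orth_proj_decomposition(1)[OF subspace_span] by (simp add: P.span_image)
  then have "norm (ip ?h' ?h') \<le>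
      norm (ip (?P x - ?P (orth_proj ?S x)) (?P x - ?P (orth_proj ?S x)))"
    by (rule orth_proj_dist_le[OF subspace_span])
  also have "\<dots> \<le> norm (ip ?h ?h)"
    using orth_proj_norm_le[OF W, of ?h] by (simp add: P.diff)
  finally show ?case
    using Cons by (simp add: gram_Cons norm_mult mult_mono)
qed simp

section \<open>Cosine of the Grassmann angle as a quotient of Gram determinants\<close>

lemma span_set_coordinates:
  assumes "x \<in> span (set vs)"
  shows "\<exists>c. x = (\<Sum>i<length vs. scale (c i) (vs ! i))"
  using assms
proof (induction vs arbitrary: x)
  case (Cons v vs)
  then obtain k where "x - scale k v \<in> span (set vs)"
    by (auto simp: span_insert)
  then obtain c where "x - scale k v = (\<Sum>i<length vs. scale (c i) (vs ! i))"
    using Cons.IH by blast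
  then have "x = scale k v + (\<Sum>i<length vs. scale (c i) (vs ! i))"
    by (simp add: algebra_simps)
  \<comment> \<open>Prepending \<open>k\<close> shifts the old coordinates by one, in step with the
    positions in \<open>v # vs\<close>.\<close>
  then have "x = (\<Sum>i<length (v # vs). scale (case_nat k c i) ((v # vs) ! i))"
    by (simp add: sum.lessThan_Suc_shift del: sum.lessThan_Suc)
  then show ?case by blast
qed simp

text \<open>The factor \<open>d\<close> is the squared modulus of the determinant of the change of basis;
  what matters is that it does not depend on \<open>f\<close>.\<close>

lemma gram_map_change_of_basis:
  assumes len: "length us = length vs" and us: "set us \<subseteq> span (set vs)"
  obtains d where "\<And>f. Vector_Spaces.linear scale scale f \<Longrightarrow>
    gram (map f us) (map f us) = d * gram (map f vs) (map f vs)"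
proof -
  let ?n = "length vs"
  have "\<exists>c. us ! j = (\<Sum>i<?n. scale (c i) (vs ! i))" if "j < ?n" for j
    using span_set_coordinates us len that by (metis nth_mem subsetD)
  then obtain c where c: "\<And>j. j < ?n \<Longrightarrow> us ! j = (\<Sum>i<?n. scale (c j i) (vs ! i))"
    by metis
  let ?A = "mat ?n ?n (\<lambda>(i, j). c j i)" and ?B = "mat ?n ?n (\<lambda>(i, j). conjugate (c i j))"
  have "gram (map f us) (map f us) = (det ?B * det ?A) * gram (map f vs) (map f vs)"
    if "Vector_Spaces.linear scale scale f" for f
  proof -
    interpret f: Vector_Spaces.linear scale scale f by fact
    let ?M = "mat ?n ?n (\<lambda>(i, j). ip (f (vs ! i)) (f (vs ! j)))"
    let ?U = "mat ?n ?n (\<lambda>(i, j). ip (f (us ! i)) (f (us ! j)))"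
    \<comment> \<open>Change of basis for a sesquilinear form: the columns of \<open>?A\<close> are
      the coordinates of \<open>us\<close>, and \<open>?B\<close> is the conjugate transpose of
      \<open>?A\<close>. Linearity of \<open>f\<close> keeps these coordinates for the
      images.\<close>
    have "?U = ?B * (?M * ?A)"
      by (rule eq_matI)
        (auto simp: c f.sum f.scale ip_sum_left ip_sum_right ip_scale_left ip_scale_right
          scalar_prod_def sum_distrib_left lessThan_atLeast0 ac_simps intro!: sum.cong)
    then have "det ?U = det ?B * (det ?M * det ?A)"
      by (simp add: det_mult[of ?B ?n "?M * ?A"] det_mult[of ?M ?n ?A]
          mult_carrier_mat[of ?M ?n ?n ?A ?n])
    moreover have "gram (map f us) (map f us) = det ?U"
      by (auto simp: gram_def len intro!: arg_cong[where f = det] eq_matI)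
    moreover have "gram (map f vs) (map f vs) = det ?M"
      by (auto simp: gram_def intro!: arg_cong[where f = det] eq_matI)
    ultimately show ?thesis by simp
  qed
  then show ?thesis by (rule that)
qed

text \<open>This makes the angle independent of the blade: the same \<open>d\<close> relates the
  Gram determinants for \<open>f\<close> and for the identity map, so it cancels in the
  quotient.\<close>

lemma gram_map_ratio:
  assumes f: "Vector_Spaces.linear scale scale f"
    and span: "span (set us) = span (set vs)"
    and nz: "gram us us \<noteq> 0" "gram vs vs \<noteq> 0"
  shows "gram (map f us) (map f us) / gram us us = gram (map f vs) (map f vs) / gram vs vs"
proof -
  \<comment> \<open>Nonzero Gram determinants make both lists bases of the common span.\<close>
  have "length us = length vs"
    using nz dim_eq_card[OF span] dim_eq_card_independent[of "set vs"]
    by (simp add: gram_nonzero_iff distinct_card)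
  moreover have "set us \<subseteq> span (set vs)"
    using span span_superset by blast
  ultimately obtain d where d: "\<And>f. Vector_Spaces.linear scale scale f \<Longrightarrow>
      gram (map f us) (map f us) = d * gram (map f vs) (map f vs)"
    by (rule gram_map_change_of_basis) blast
  have "gram us us = d * gram vs vs"
    using d[OF linear_id] by simp
  then show ?thesis
    using d[OF f] nz by (simp add: field_simps)
qed

lemma mv_norm_scaled_wedge:
  "mv_norm (\<lambda>\<omega>. c * wedge vs \<omega>) = sqrt (norm (conjugate c * c) * norm (gram vs vs))"
  using mv_inner_combination[of "\<lambda>_. c" "\<lambda>_. vs" "{()}" "\<lambda>_. c" "\<lambda>_. vs" "{()}"]
  by (simp add: mv_norm_def norm_mult)

lemma mv_map_scaled_wedge:
  assumes "Vector_Spaces.linear scale scale f"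
  shows "mv_map f (\<lambda>\<omega>. c * wedge vs \<omega>) = (\<lambda>\<omega>. c * wedge (map f vs) \<omega>)"
  using mv_map_combination[OF assms, of "\<lambda>_. c" "\<lambda>_. vs" "{()}"] by simp

lemma blade_representsE:
  assumes "blade_represents \<nu> V"
  obtains c vs where "\<nu> = (\<lambda>\<omega>. c * wedge vs \<omega>)" "span (set vs) = V" "c \<noteq> 0" "gram vs vs \<noteq> 0"
proof -
  from assms obtain c vs where
    *: "\<nu> \<noteq> (\<lambda>_. 0)" "\<nu> = (\<lambda>\<omega>. c * wedge vs \<omega>)" "span (set vs) = V"
    unfolding blade_represents_def by blast
  then have "c \<noteq> 0" by auto
  moreover have "gram vs vs \<noteq> 0"
    using * alternating_eq_0[of _ vs] by (auto simp: wedge_def fun_eq_iff split: if_splits)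
  ultimately show ?thesis using that * by blast
qed

lemma blade_represents_wedge:
  assumes "gram vs vs \<noteq> 0"
  shows "blade_represents (wedge vs) (span (set vs))"
proof -
  \<comment> \<open>The alternating form \<open>gram vs\<close> itself witnesses that the wedge
    product is not zero.\<close>
  have "wedge vs (gram vs) \<noteq> 0"
    using assms by (simp add: wedge_def alternating_gram)
  then show ?thesis
    unfolding blade_represents_def by (metis mult_1)
qed

text \<open>By \<open>gram_map_ratio\<close> all representing blades give the same quotient of
  norms, so \<open>arccos\<close> of it meets the definite description in
  \<open>grassmann_angle\<close>.\<close>

lemma cos_grassmann_angle:
  assumes W: "subspace W" and nz: "gram vs vs \<noteq> 0"
  shows "cos (grassmann_angle (span (set vs)) W) =
    sqrt (norm (gram (map (orth_proj W) vs) (map (orth_proj W) vs)) / norm (gram vs vs))"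
    (is "_ = ?r")
proof -
  let ?P = "orth_proj W" and ?V = "span (set vs)"
  have P: "Vector_Spaces.linear scale scale ?P" by (rule linear_orth_proj[OF W])
  have ratio: "mv_norm (mv_map ?P \<nu>) / mv_norm \<nu> = ?r" if "blade_represents \<nu> ?V" for \<nu>
  proof -
    from that obtain c us where u: "\<nu> = (\<lambda>\<omega>. c * wedge us \<omega>)" "span (set us) = ?V" "c \<noteq> 0"
      "gram us us \<noteq> 0" by (rule blade_representsE)
    have "mv_norm (mv_map ?P \<nu>) / mv_norm \<nu> =
        sqrt (norm (gram (map ?P us) (map ?P us) / gram us us))"
      using u(3) by (simp add: u(1) mv_map_scaled_wedge[OF P] mv_norm_scaled_wedge
          norm_divide norm_mult real_sqrt_mult real_sqrt_divide)
    then show ?thesis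
      unfolding gram_map_ratio[OF P u(2,4) nz] by (simp add: norm_divide)
  qed
  have r: "0 \<le> ?r" "?r \<le> 1"
    using gram_map_orth_proj_le[OF W, of vs] nz by (simp_all add: divide_le_eq)
  then have r1: "- 1 \<le> ?r" by linarith
  have "grassmann_angle ?V W = arccos ?r"
    unfolding grassmann_angle_def
  proof (rule the_equality)
    show "0 \<le> arccos ?r \<and> arccos ?r \<le> pi / 2 \<and> (\<forall>\<nu>. blade_represents \<nu> ?V \<longrightarrow>
        cos (arccos ?r) = mv_norm (mv_map ?P \<nu>) / mv_norm \<nu>)"
      using r ratio arccos_le_pi2[of ?r] arccos_lbound[OF r1] cos_arccos[OF r1] by metis
    show "\<theta> = arccos ?r"
      if "0 \<le> \<theta> \<and> \<theta> \<le> pi / 2 \<and> (\<forall>\<nu>. blade_represents \<nu> ?V \<longrightarrow>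
        cos \<theta> = mv_norm (mv_map ?P \<nu>) / mv_norm \<nu>)" for \<theta>
    proof -
      \<comment> \<open>A representing blade exists, so the condition on \<open>\<theta>\<close> is
        not vacuous and fixes its cosine.\<close>
      have "cos \<theta> = ?r"
        using that blade_represents_wedge[OF nz] ratio by metis
      then show ?thesis
        using that arccos_cos[of \<theta>] by simp
    qed
  qed
  then show ?thesis
    using cos_arccos[OF r1 r(2)] by simp
qed

section \<open>Orthogonal partitions\<close>

lemma cos_grassmann_angle_orth_sum:
  assumes W: "subspace W" and A: "subspace A" and B: "subspace B"
    and orth: "\<And>a b. a \<in> A \<Longrightarrow> b \<in> B \<Longrightarrow> ip a b = 0"
  shows "cos (grassmann_angle {a + b | a b. a \<in> A \<and> b \<in> B} W) =
    cos (grassmann_angle A W) * cos (grassmann_angle B W) *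
    cos (compl_grassmann_angle (orth_proj W ` A) (orth_proj W ` B))"
proof -
  let ?P = "orth_proj W"
  let ?U = "orth_compl (?P ` B)"
  let ?Q = "orth_proj ?U"
  interpret P: Vector_Spaces.linear scale scale ?P by (rule linear_orth_proj[OF W])
  obtain as where as: "gram as as \<noteq> 0" "span (set as) = A"
    using subspace_basis_list[OF A] gram_nonzero_iff by metis
  obtain bs where bs: "gram bs bs \<noteq> 0" "span (set bs) = B"
    using subspace_basis_list[OF B] gram_nonzero_iff by metis
  let ?a = "map ?P as" and ?b = "map ?P bs"
  have ab: "gram (as @ bs) (as @ bs) = gram as as * gram bs bs"
    by (rule gram_append_orth) (use as bs orth span_base in blast)
  have spanab: "span (set (as @ bs)) = {a + b | a b. a \<in> A \<and> b \<in> B}"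
    by (simp add: span_Un as bs)
  have span_a: "span (set ?a) = ?P ` A" and span_b: "span (set ?b) = ?P ` B"
    using P.span_image as(2) bs(2) by auto
  have PB: "subspace (?P ` B)"
    using span_b subspace_span by metis
  \<comment> \<open>\<open>?Q\<close> changes each vector of \<open>?a\<close> only by an element of
    the span of \<open>?b\<close>.\<close>
  have "gram (?a @ ?b) (?a @ ?b) = gram (map ?Q ?a @ ?b) (map ?Q ?a @ ?b)"
    by (rule gram_append_cong[symmetric]) (unfold span_b, rule diff_orth_proj_orth_compl[OF PB])
  also have "\<dots> = gram (map ?Q ?a) (map ?Q ?a) * gram ?b ?b"
  proof (rule gram_append_orth)
    fix x y assume "x \<in> set (map ?Q ?a)" "y \<in> set ?b"
    then have "x \<in> ?U" "y \<in> ?P ` B"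
      using orth_proj_decomposition(1)[OF subspace_orth_compl] bs(2) span_base by auto
    then show "ip x y = 0"
      using orth_complD ip_commute_zero by blast
  qed
  finally have Pab: "gram (?a @ ?b) (?a @ ?b) = gram (map ?Q ?a) (map ?Q ?a) * gram ?b ?b" .
  have V: "cos (grassmann_angle {a + b | a b. a \<in> A \<and> b \<in> B} W) =
      sqrt (norm (gram (map ?Q ?a) (map ?Q ?a)) * norm (gram ?b ?b) /
        (norm (gram as as) * norm (gram bs bs)))"
    using cos_grassmann_angle[OF W, of "as @ bs"] as bs
    unfolding spanab by (simp add: ab Pab[simplified] norm_mult)
  have cA: "cos (grassmann_angle A W) = sqrt (norm (gram ?a ?a) / norm (gram as as))"
    using cos_grassmann_angle[OF W as(1)] as(2) by simp
  have cB: "cos (grassmann_angle B W) = sqrt (norm (gram ?b ?b) / norm (gram bs bs))"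
    using cos_grassmann_angle[OF W bs(1)] bs(2) by simp
  show ?thesis
  proof (cases "gram ?a ?a = 0")
    \<comment> \<open>Here \<open>?a\<close> is not a basis, so the complementary angle is left
      unevaluated: the factor for \<open>A\<close> is zero, and so is the left side, because
      applying \<open>?Q\<close> cannot increase the volume.\<close>
    case True
    then have "gram (map ?Q ?a) (map ?Q ?a) = 0"
      using gram_map_orth_proj_le[OF subspace_orth_compl, of "?P ` B" ?a] by simp
    with True show ?thesis unfolding V cA by simp
  next
    case False
    then have "cos (compl_grassmann_angle (?P ` A) (?P ` B)) =
        sqrt (norm (gram (map ?Q ?a) (map ?Q ?a)) / norm (gram ?a ?a))"
      unfolding compl_grassmann_angle_def
      using cos_grassmann_angle[OF subspace_orth_compl False, of "?P ` B"] span_a by simp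
    with False show ?thesis
      unfolding V cA cB by (simp add: real_sqrt_mult real_sqrt_divide)
  qed
qed

lemma subspace_subspace_sum:
  assumes "\<And>i. i \<in> I \<Longrightarrow> subspace (Vs i)"
  shows "subspace (subspace_sum Vs I)"
proof (rule subspaceI)
  show "0 \<in> subspace_sum Vs I"
    unfolding subspace_sum_def using assms
    by (auto intro!: exI[of _ "\<lambda>_. 0"] simp: subspace_0)
next
  fix x y assume "x \<in> subspace_sum Vs I" "y \<in> subspace_sum Vs I"
  then obtain f g where "x = sum f I" "y = sum g I" "\<forall>i\<in>I. f i \<in> Vs i" "\<forall>i\<in>I. g i \<in> Vs i"
    unfolding subspace_sum_def by blast
  then show "x + y \<in> subspace_sum Vs I"
    unfolding subspace_sum_def using assms
    by (auto intro!: exI[of _ "\<lambda>i. f i + g i"] simp: subspace_add sum.distrib)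
next
  fix c x assume "x \<in> subspace_sum Vs I"
  then obtain f where "x = sum f I" "\<forall>i\<in>I. f i \<in> Vs i"
    unfolding subspace_sum_def by blast
  then show "scale c x \<in> subspace_sum Vs I"
    unfolding subspace_sum_def using assms
    by (auto intro!: exI[of _ "\<lambda>i. scale c (f i)"] simp: subspace_scale scale_sum_right)
qed

end

lemma subspace_sum_singleton: "subspace_sum Vs {i} = Vs i"
  unfolding subspace_sum_def by (auto intro: exI[of _ "\<lambda>_. _"])

lemma subspace_sum_insert:
  assumes "finite I" "j \<notin> I"
  shows "subspace_sum Vs (insert j I) = {a + b | a b. a \<in> Vs j \<and> b \<in> subspace_sum Vs I}"
proof (intro subset_antisym subsetI)
  fix x assume "x \<in> subspace_sum Vs (insert j I)"
  then show "x \<in> {a + b | a b. a \<in> Vs j \<and> b \<in> subspace_sum Vs I}"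
    using assms unfolding subspace_sum_def by auto
next
  fix x assume "x \<in> {a + b | a b. a \<in> Vs j \<and> b \<in> subspace_sum Vs I}"
  then obtain a f where f: "x = a + sum f I" "a \<in> Vs j" "\<forall>i\<in>I. f i \<in> Vs i"
    unfolding subspace_sum_def by blast
  have "sum (f(j := a)) I = sum f I"
    using assms(2) by (intro sum.cong) auto
  then have "x = sum (f(j := a)) (insert j I)" "\<forall>i\<in>insert j I. (f(j := a)) i \<in> Vs i"
    using f assms by auto
  then show "x \<in> subspace_sum Vs (insert j I)"
    unfolding subspace_sum_def by blast
qed

text \<open>The lower index \<open>m\<close> is variable so that induction can run downwards from
  \<open>k\<close>. Each step applies the case of two summands to \<open>Vs m\<close> and the sum of
  the later subspaces; at \<open>m = k\<close> the second product is empty.\<close>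

lemma (in fin_dim_inner_space) cos_grassmann_angle_subspace_sum:
  fixes m k :: nat
  assumes W: "subspace W" and "m \<le> k"
    and sub: "\<And>i. i \<in> {m..k} \<Longrightarrow> subspace (Vs i)"
    and orth: "\<And>i j x y. \<lbrakk>i \<in> {m..k}; j \<in> {m..k}; i \<noteq> j; x \<in> Vs i; y \<in> Vs j\<rbrakk> \<Longrightarrow> ip x y = 0"
  shows "cos (grassmann_angle (subspace_sum Vs {m..k}) W) =
    (\<Prod>i=m..k. cos (grassmann_angle (Vs i) W)) *
    (\<Prod>i=m..<k. cos (compl_grassmann_angle (orth_proj W ` Vs i)
        (orth_proj W ` subspace_sum Vs {i+1..k})))"
  using \<open>m \<le> k\<close> sub orth
proof (induction m rule: inc_induct)
  case base
  show ?case by (simp add: subspace_sum_singleton)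
next
  case (step m)
  have split: "{m..k} = insert m {Suc m..k}" and split': "{m..<k} = insert m {Suc m..<k}"
    using step.hyps by auto
  have "ip a b = 0" if a: "a \<in> Vs m" and b: "b \<in> subspace_sum Vs {Suc m..k}" for a b
  proof -
    from b obtain f where f: "b = sum f {Suc m..k}" "\<forall>i\<in>{Suc m..k}. f i \<in> Vs i"
      unfolding subspace_sum_def by blast
    have "ip a (f i) = 0" if "i \<in> {Suc m..k}" for i
      using f(2) that a step.hyps by (intro step.prems(2)[of m i]) auto
    then show ?thesis by (simp add: f(1) ip_sum_right)
  qed
  moreover have "subspace (Vs m)" "subspace (subspace_sum Vs {Suc m..k})"
    using step.prems(1) step.hyps by (auto intro!: subspace_subspace_sum)
  ultimately have "cos (grassmann_angle (subspace_sum Vs {m..k}) W) =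
      cos (grassmann_angle (Vs m) W) * cos (grassmann_angle (subspace_sum Vs {Suc m..k}) W) *
      cos (compl_grassmann_angle (orth_proj W ` Vs m) (orth_proj W ` subspace_sum Vs {Suc m..k}))"
    unfolding split by (subst subspace_sum_insert)
      (auto intro!: cos_grassmann_angle_orth_sum[OF W])
  also have "cos (grassmann_angle (subspace_sum Vs {Suc m..k}) W) =
      (\<Prod>i=Suc m..k. cos (grassmann_angle (Vs i) W)) *
      (\<Prod>i=Suc m..<k. cos (compl_grassmann_angle (orth_proj W ` Vs i)
        (orth_proj W ` subspace_sum Vs {i+1..k})))"
  proof (rule step.IH)
    show "subspace (Vs i)" if "i \<in> {Suc m..k}" for i
      using step.prems(1) that by simp
    show "ip x y = 0"
      if "i \<in> {Suc m..k}" "j \<in> {Suc m..k}" "i \<noteq> j" "x \<in> Vs i" "y \<in> Vs j" for i j x y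
      using that by (intro step.prems(2)[of i j x y]) auto
  qed
  finally show ?case
    unfolding split' by (subst split) (simp add: ac_simps)
qed

theorem corollary5p12:
  fixes scale :: "'k::real_or_complex \<Rightarrow> 'x::ab_group_add \<Rightarrow> 'x"
    and ip :: "'x \<Rightarrow> 'x \<Rightarrow> 'k"
    and V W :: "'x set" and Vs :: "nat \<Rightarrow> 'x set" and k :: nat and P :: "'x \<Rightarrow> 'x"
  assumes "fin_dim_inner_space scale ip"
    and "module.subspace scale V" and "module.subspace scale W"
    and "P = fin_dim_inner_space.orth_proj ip W"
    and "k \<ge> 1"
    and "fin_dim_inner_space.orthogonal_partition scale ip V k Vs"
  shows "cos (fin_dim_inner_space.grassmann_angle scale ip V W) =
    (\<Prod>i=1..k. cos (fin_dim_inner_space.grassmann_angle scale ip (Vs i) W)) *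
    (\<Prod>i=1..k-1. cos (fin_dim_inner_space.compl_grassmann_angle scale ip
        (P ` Vs i) (P ` subspace_sum Vs {i+1..k})))"
proof -
  interpret fin_dim_inner_space scale ip by fact
  have part: "\<And>i. i \<in> {1..k} \<Longrightarrow> subspace (Vs i)"
    "\<And>i j x y. \<lbrakk>i \<in> {1..k}; j \<in> {1..k}; i \<noteq> j; x \<in> Vs i; y \<in> Vs j\<rbrakk> \<Longrightarrow> ip x y = 0"
    "V = subspace_sum Vs {1..k}"
    using assms(6) unfolding orthogonal_partition_def by blast+
  \<comment> \<open>The induction was stated with a half-open range, which avoids truncated
    subtraction.\<close>
  have "{1..k-1} = {1..<k}"
    using \<open>k \<ge> 1\<close> by auto
  then show ?thesis
    using cos_grassmann_angle_subspace_sum[OF assms(3,5) part(1,2)]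
    by (simp only: part(3) assms(4))
qed

end
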